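(* Let $(X,d)$ be a nonempty compact metric space, let $(\mathcal{U}_{4\epsilon_n}(A_n),q_{n,n+1})$ be a FASO for $X$ with inverse limit $\mathcal{X}$, and let $\mathcal{X}_*=\phi(X)\subseteq\mathcal{X}$ (with the subspace topology), where $\phi:X\to\mathcal{X}$, $\phi(x)=\{X_*^n\}_{n\in\mathbb{N}}$. Then $X$ is homeomorphic to $\mathcal{X}_*$.
   Context: For $\epsilon>0$, a finite subset $A\subseteq X$ is an $\epsilon$-approximation of $X$ if for every $x\in X$ there is $a\in A$ with $d(x,a)<\epsilon$. $\mathcal{B}(x,\epsilon)$ is the open ball. For an $\epsilon$-approximation $A$, $\mathcal{U}_{4\epsilon}(A)$ is the finite set of all nonempty $C\subseteq A$ with $\mathrm{diam}(C)<4\epsilon$, ordered by $C\leq D$ iff $D\subseteq C$, with the topology whose open sets are the lower sets of $\leq$ (the minimal open neighborhood of $C$ is $\{D : C\subseteq D\}$). A FASO (finite approximative sequence with opposite order) for $X$ is an inverse sequence $(\mathcal{U}_{4\epsilon_n}(A_n),q_{n,n+1})_{n\in\mathbb{N}}$, $\mathbb{N}=\{1,2,\dots\}$, where $\epsilon_1>\mathrm{diam}(X)$, each $A_n$ is an $\epsilon_n$-approximation of $X$ ($A_1$ may be a single point), $\gamma_n=\sup\{d(x,A_n) : x\in X\}$, $0<\epsilon_{n+1}<\frac{\epsilon_n-\gamma_n}{2}$ for all $n$, and $q_{n,n+1}:\mathcal{U}_{4\epsilon_{n+1}}(A_{n+1})\to\mathcal{U}_{4\epsilon_n}(A_n)$,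 $q_{n,n+1}(C)=\bigcup_{x\in C}\mathcal{B}(x,\epsilon_n)\cap A_n$ (these maps are well-defined and continuous). For $n<m$, $q_{n,m}=q_{n,n+1}\circ\cdots\circ q_{m-1,m}$. The inverse limit $\mathcal{X}$ is the subspace of $\prod_n\mathcal{U}_{4\epsilon_n}(A_n)$ of sequences $\{C_n\}$ with $q_{n,n+1}(C_{n+1})=C_n$ for all $n$. For $x\in X$ and $n\in\mathbb{N}$: $A_m(x)=\{a\in A_m : d(x,a)=d(x,A_m)\}$ and $X_*^n=\bigcup_{m>n}q_{n,m}(A_m(x))$; the sequence $\{X_*^n\}_{n\in\mathbb{N}}$ is an element of $\mathcal{X}$. *)

theory Defs
  imports "HOL-Analysis.Analysis"
begin

text \<open>
  A metric space is rendered as a subset \<open>X\<close> of a type of class \<open>metric_space\<close>, with the metric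
  \<open>dist\<close> and the topology \<open>top_of_set X\<close>.  Sequences \<open>\<epsilon>\<close>, \<open>A\<close> are functions on \<open>nat\<close> of which only
  the values at indices \<open>n \<ge> 1\<close> matter.
\<close>

definition eps_approximation :: "'a::metric_space set \<Rightarrow> real \<Rightarrow> 'a set \<Rightarrow> bool" where
  "eps_approximation X e A \<longleftrightarrow>
     0 < e \<and> finite A \<and> A \<subseteq> X \<and> (\<forall>x\<in>X. \<exists>a\<in>A. dist x a < e)"

definition small_subsets :: "real \<Rightarrow> 'a::metric_space set \<Rightarrow> 'a set set" where
  "small_subsets r A = {C. C \<noteq> {} \<and> C \<subseteq> A \<and> diameter C < r}"

definition opp_le :: "'a set \<Rightarrow> 'a set \<Rightarrow> bool" where
  "opp_le C D \<longleftrightarrow> D \<subseteq> C"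

definition small_subsets_topology :: "real \<Rightarrow> 'a::metric_space set \<Rightarrow> 'a set topology" where
  "small_subsets_topology r A = topology (\<lambda>S. S \<subseteq> small_subsets r A \<and>
     (\<forall>C\<in>S. \<forall>D\<in>small_subsets r A. opp_le D C \<longrightarrow> D \<in> S))"

definition gap :: "'a::metric_space set \<Rightarrow> 'a set \<Rightarrow> real" where
  "gap X A = (SUP x\<in>X. infdist x A)"

text \<open>
  The inverse sequence of a FASO is determined by \<open>\<epsilon>\<close> and \<open>A\<close>: its spaces are
  \<open>small_subsets_topology (4 * \<epsilon> n) (A n)\<close> and its bonding maps are \<open>bond \<epsilon> A n\<close>, from
  stage \<open>n + 1\<close> to stage \<open>n\<close>.
\<close>

definition faso :: "'a::metric_space set \<Rightarrow> (nat \<Rightarrow> real) \<Rightarrow> (nat \<Rightarrow> 'a set) \<Rightarrow> bool" where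
  "faso X \<epsilon> A \<longleftrightarrow>
     diameter X < \<epsilon> 1 \<and>
     (\<forall>n\<ge>1. eps_approximation X (\<epsilon> n) (A n)) \<and>
     (\<forall>n\<ge>1. 0 < \<epsilon> (Suc n) \<and> \<epsilon> (Suc n) < (\<epsilon> n - gap X (A n)) / 2)"

definition bond :: "(nat \<Rightarrow> real) \<Rightarrow> (nat \<Rightarrow> 'a::metric_space set) \<Rightarrow> nat \<Rightarrow> 'a set \<Rightarrow> 'a set" where
  "bond \<epsilon> A n C = (\<Union>x\<in>C. ball x (\<epsilon> n) \<inter> A n)"

text \<open>
  \<open>bonds \<epsilon> A n m\<close> is the composite \<open>bond \<epsilon> A n \<circ> \<dots> \<circ> bond \<epsilon> A (m - 1)\<close> for \<open>n < m\<close>; it is set to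
  the identity for \<open>m \<le> n\<close>.
\<close>

primrec bonds :: "(nat \<Rightarrow> real) \<Rightarrow> (nat \<Rightarrow> 'a::metric_space set) \<Rightarrow> nat \<Rightarrow> nat \<Rightarrow> 'a set \<Rightarrow> 'a set" where
  "bonds \<epsilon> A n 0 = id"
| "bonds \<epsilon> A n (Suc m) = (if n \<le> m then bonds \<epsilon> A n m \<circ> bond \<epsilon> A m else id)"

definition inverse_limit ::
  "(nat \<Rightarrow> real) \<Rightarrow> (nat \<Rightarrow> 'a::metric_space set) \<Rightarrow> (nat \<Rightarrow> 'a set) topology" where
  "inverse_limit \<epsilon> A =
     subtopology (product_topology (\<lambda>n. small_subsets_topology (4 * \<epsilon> n) (A n)) {1..})
       {C. \<forall>n\<ge>1. bond \<epsilon> A n (C (Suc n)) = C n}"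

definition nearest :: "'a::metric_space set \<Rightarrow> 'a \<Rightarrow> 'a set" where
  "nearest A x = {a \<in> A. dist x a = infdist x A}"

definition star_seq ::
  "(nat \<Rightarrow> real) \<Rightarrow> (nat \<Rightarrow> 'a::metric_space set) \<Rightarrow> 'a \<Rightarrow> nat \<Rightarrow> 'a set" where
  "star_seq \<epsilon> A x n = (\<Union>m\<in>{n<..}. bonds \<epsilon> A n m (nearest (A m) x))"

text \<open>Points of \<open>product_topology _ {1..}\<close> are functions that are \<open>undefined\<close> at \<open>0\<close>.\<close>

definition phi ::
  "(nat \<Rightarrow> real) \<Rightarrow> (nat \<Rightarrow> 'a::metric_space set) \<Rightarrow> 'a \<Rightarrow> nat \<Rightarrow> 'a set" where
  "phi \<epsilon> A x = (\<lambda>n\<in>{1..}. star_seq \<epsilon> A x n)"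

definition star_space ::
  "'a::metric_space set \<Rightarrow> (nat \<Rightarrow> real) \<Rightarrow> (nat \<Rightarrow> 'a set) \<Rightarrow> (nat \<Rightarrow> 'a set) topology" where
  "star_space X \<epsilon> A = subtopology (inverse_limit \<epsilon> A) (phi \<epsilon> A ` X)"


text \<open>
  Well-definedness: the lower sets form a topology on the stated set of points, and \<open>\<phi>\<close> takes its
  values in the inverse limit, so the points of \<open>star_space X \<epsilon> A\<close> are exactly \<open>phi \<epsilon> A ` X\<close>.
\<close>

lemma openin_small_subsets_topology:
  "openin (small_subsets_topology r A) S \<longleftrightarrow> S \<subseteq> small_subsets r A \<and>
     (\<forall>C\<in>S. \<forall>D\<in>small_subsets r A. opp_le D C \<longrightarrow> D \<in> S)"
proof -
  have "istopology (\<lambda>S. S \<subseteq> small_subsets r A \<and>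
     (\<forall>C\<in>S. \<forall>D\<in>small_subsets r A. opp_le D C \<longrightarrow> D \<in> S))"
    unfolding istopology_def by blast
  then show ?thesis
    unfolding small_subsets_topology_def by (simp add: topology_inverse')
qed

lemma topspace_small_subsets_topology [simp]:
  "topspace (small_subsets_topology r A) = small_subsets r A"
  unfolding topspace_def openin_small_subsets_topology by blast

lemma bond_mono: "C \<subseteq> D \<Longrightarrow> bond \<epsilon> A n C \<subseteq> bond \<epsilon> A n D"
  unfolding bond_def by blast

lemma bond_UN: "bond \<epsilon> A n (\<Union>i\<in>I. F i) = (\<Union>i\<in>I. bond \<epsilon> A n (F i))"
  unfolding bond_def by blast

lemma bonds_refl [simp]: "bonds \<epsilon> A n n = id"
  by (cases n) auto

lemma bonds_first: "n < m \<Longrightarrow> bonds \<epsilon> A n m = bond \<epsilon> A n \<circ> bonds \<epsilon> A (Suc n) m"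
proof (induction m)
  case (Suc m)
  show ?case
  proof (cases "n = m")
    case False
    then show ?thesis using Suc by (simp add: o_assoc)
  qed simp
qed simp

lemma nearest_nonempty:
  assumes "finite A" "A \<noteq> {}"
  shows "nearest A x \<noteq> {}"
proof -
  have "infdist x A = Min (dist x ` A)"
    using assms by (simp add: infdist_def cInf_eq_Min)
  moreover have "Min (dist x ` A) \<in> dist x ` A"
    using assms by (intro Min_in) auto
  ultimately show ?thesis unfolding nearest_def by fastforce
qed

lemma infdist_le_gap:
  assumes "compact X" "x \<in> X"
  shows "infdist x A \<le> gap X A"
proof -
  have "compact ((\<lambda>x. infdist x A) ` X)"
    by (intro compact_continuous_image continuous_intros assms)
  then show ?thesis
    unfolding gap_def using assms(2) by (intro cSUP_upper) (auto intro: bounded_imp_bdd_above compact_imp_bounded)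
qed

lemma infdist_less_eps: "eps_approximation X e A \<Longrightarrow> x \<in> X \<Longrightarrow> infdist x A < e"
  unfolding eps_approximation_def by (meson infdist_le le_less_trans)

lemma bond_nearest_chain:
  assumes "compact X" "faso X \<epsilon> A" "x \<in> X" "n \<ge> 1"
  shows "nearest (A n) x \<subseteq> bond \<epsilon> A n (nearest (A (Suc n)) x)"
proof
  fix a assume a: "a \<in> nearest (A n) x"
  have e: "eps_approximation X (\<epsilon> n) (A n)" "eps_approximation X (\<epsilon> (Suc n)) (A (Suc n))"
      "0 < \<epsilon> (Suc n)" "\<epsilon> (Suc n) < (\<epsilon> n - gap X (A n)) / 2"
    using assms unfolding faso_def by auto
  obtain b where b: "b \<in> nearest (A (Suc n)) x"
    using nearest_nonempty[of "A (Suc n)" x] e(2) assms(3) unfolding eps_approximation_def by blast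
  have "dist x b < \<epsilon> (Suc n)" "dist x a \<le> gap X (A n)"
    using a b infdist_less_eps[OF e(2) assms(3)] infdist_le_gap[OF assms(1,3)]
    unfolding nearest_def by auto
  then have "dist b a < \<epsilon> n"
    using e(3,4) dist_triangle3[of b a x] by (auto simp: field_simps)
  then show "a \<in> bond \<epsilon> A n (nearest (A (Suc n)) x)"
    using a b unfolding bond_def nearest_def by auto
qed

lemma bonds_nearest_close:
  assumes "compact X" "faso X \<epsilon> A" "x \<in> X"
  shows "n \<le> m \<Longrightarrow> n \<ge> 1 \<Longrightarrow> a \<in> bonds \<epsilon> A n m (nearest (A m) x) \<Longrightarrow> a \<in> A n \<and> dist x a < 2 * \<epsilon> n"
proof (induction n arbitrary: a rule: inc_induct)
  case base
  then have "eps_approximation X (\<epsilon> m) (A m)" using assms unfolding faso_def by auto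
  from infdist_less_eps[OF this assms(3)] this base show ?case
    unfolding eps_approximation_def nearest_def by auto
next
  case (step n)
  have e: "\<epsilon> (Suc n) < (\<epsilon> n - gap X (A n)) / 2"
    using assms step.prems unfolding faso_def by auto
  have g: "0 \<le> gap X (A n)"
    using infdist_le_gap[OF assms(1,3)] infdist_nonneg order_trans by blast
  from step.prems(2) obtain b where b: "b \<in> bonds \<epsilon> A (Suc n) m (nearest (A m) x)"
      "dist b a < \<epsilon> n" "a \<in> A n"
    unfolding bonds_first[OF step.hyps(2)] bond_def by auto
  have "dist x b < 2 * \<epsilon> (Suc n)" using step.IH b(1) by auto
  then show ?case
    using b e g dist_triangle[of x a b] by (auto simp: field_simps)
qed

lemma phi_in_inverse_limit:
  assumes "compact X" "faso X \<epsilon> A" "x \<in> X"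
  shows "phi \<epsilon> A x \<in> topspace (inverse_limit \<epsilon> A)"
proof -
  have mem: "star_seq \<epsilon> A x n \<in> small_subsets (4 * \<epsilon> n) (A n)" if n: "n \<ge> 1" for n
  proof -
    let ?S = "star_seq \<epsilon> A x n"
    have close: "a \<in> A n \<and> dist x a < 2 * \<epsilon> n" if "a \<in> ?S" for a
    proof -
      obtain m where "n < m" "a \<in> bonds \<epsilon> A n m (nearest (A m) x)"
        using \<open>a \<in> ?S\<close> unfolding star_seq_def by blast
      then show ?thesis using bonds_nearest_close[OF assms less_imp_le n] by blast
    qed
    have "finite (A n)" "eps_approximation X (\<epsilon> n) (A n)"
      using assms n unfolding faso_def eps_approximation_def by auto
    have "?S \<subseteq> A n" using close by blast
    then have fin: "finite ?S" using \<open>finite (A n)\<close> finite_subset by blast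
    have "A n \<noteq> {}"
      using \<open>eps_approximation X (\<epsilon> n) (A n)\<close> assms(3) unfolding eps_approximation_def by auto
    then have ne: "nearest (A n) x \<noteq> {}" using nearest_nonempty \<open>finite (A n)\<close> by blast
    have "bonds \<epsilon> A n (Suc n) (nearest (A (Suc n)) x) \<subseteq> ?S"
      unfolding star_seq_def by blast
    then have "nearest (A n) x \<subseteq> ?S"
      using bond_nearest_chain[OF assms n] by simp
    then have ne': "?S \<noteq> {}" using ne by blast
    from diameter_compact_attained[OF finite_imp_compact[OF fin] ne']
    obtain a b where "a \<in> ?S" "b \<in> ?S" "dist a b = diameter ?S" by blast
    then have "diameter ?S < 4 * \<epsilon> n"
      using close[of a] close[of b] dist_triangle3[of a b x] by linarith
    then show ?thesis using ne' close unfolding small_subsets_def by blast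
  qed
  have eq: "bond \<epsilon> A n (star_seq \<epsilon> A x (Suc n)) = star_seq \<epsilon> A x n" if n: "n \<ge> 1" for n
  proof -
    let ?F = "\<lambda>m. bonds \<epsilon> A n m (nearest (A m) x)"
    have "bond \<epsilon> A n (star_seq \<epsilon> A x (Suc n)) = (\<Union>m\<in>{Suc n<..}. ?F m)"
      unfolding star_seq_def bond_UN by (rule SUP_cong) (auto simp: bonds_first[of n])
    moreover have "?F (Suc n) \<subseteq> ?F (Suc (Suc n))"
      using bond_mono[OF bond_nearest_chain[OF assms, of "Suc n"]] by simp
    moreover have "{n<..} = insert (Suc n) {Suc n<..}" by auto
    ultimately show ?thesis unfolding star_seq_def by (simp only: UN_insert) blast
  qed
  show ?thesis
    using mem eq unfolding inverse_limit_def phi_def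
    by (auto simp: topspace_subtopology)
qed

lemma topspace_star_space:
  "compact X \<Longrightarrow> faso X \<epsilon> A \<Longrightarrow> topspace (star_space X \<epsilon> A) = phi \<epsilon> A ` X"
  unfolding star_space_def topspace_subtopology using phi_in_inverse_limit by blast

end

theory Submission
  imports Defs
begin

text \<open>
  Since the radii satisfy \<open>\<epsilon> (m + 1) < (\<epsilon> m - \<gamma> m) / 2\<close>, the points of \<open>A m\<close> nearest to \<open>x\<close> are
  still caught by the bonding image of the points of \<open>A (m + 1)\<close> nearest to any \<open>y\<close> with
  \<open>d(x, y) < \<epsilon> (m + 1)\<close>.  As each coordinate of \<open>\<phi>(x)\<close> is finite and an increasing union, it is
  therefore contained in that of \<open>\<phi>(y)\<close> for all \<open>y\<close> near \<open>x\<close>, which is continuity.  Conversely the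
  \<open>n\<close>-th coordinate of \<open>\<phi>(x)\<close> lies within \<open>2 \<epsilon> n\<close> of \<open>x\<close> and \<open>\<epsilon> n \<rightarrow> 0\<close>, so minimal neighbourhoods
  of coordinates separate the points of the image.  A continuous bijection from a compact space to
  a Hausdorff space is a homeomorphism.
\<close>

lemma gap_nonneg:
  assumes "compact X" "X \<noteq> {}"
  shows "0 \<le> gap X A"
proof -
  obtain x where "x \<in> X" using assms(2) by blast
  from infdist_le_gap[OF assms(1) this, of A] show ?thesis
    using infdist_nonneg[of x A] by linarith
qed

text \<open>Gaps are nonnegative, so each radius is less than half its predecessor. The exponent
  lags the index by one because stages start at 1.\<close>

lemma faso_eps_bound:
  assumes "compact X" "X \<noteq> {}" "faso X \<epsilon> A"
  shows "\<epsilon> (Suc n) \<le> \<epsilon> 1 / 2 ^ n"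
proof (induction n)
  case (Suc n)
  have "\<epsilon> (Suc (Suc n)) < (\<epsilon> (Suc n) - gap X (A (Suc n))) / 2"
    using assms(3) unfolding faso_def by auto
  then have "\<epsilon> (Suc (Suc n)) \<le> \<epsilon> (Suc n) / 2"
    using gap_nonneg[OF assms(1,2), of "A (Suc n)"] by simp
  also have "\<dots> \<le> \<epsilon> 1 / 2 ^ n / 2"
    using Suc by (simp add: divide_right_mono)
  finally show ?case by (simp add: mult.commute)
qed simp

lemma faso_eps_small:
  assumes "compact X" "X \<noteq> {}" "faso X \<epsilon> A" "0 < r"
  obtains n where "n \<ge> 1" "\<epsilon> n < r"
proof -
  have "(\<lambda>n. \<epsilon> 1 / 2 ^ n) \<longlonglongrightarrow> 0"
    by (rule LIMSEQ_divide_realpow_zero) simp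
  from order_tendstoD(2)[OF this assms(4)] obtain n where "\<epsilon> 1 / 2 ^ n < r"
    unfolding eventually_sequentially by blast
  then show thesis
    using faso_eps_bound[OF assms(1-3), of n] that[of "Suc n"] by force
qed

lemma bonds_mono: "C \<subseteq> D \<Longrightarrow> bonds \<epsilon> A n m C \<subseteq> bonds \<epsilon> A n m D"
  by (induction m arbitrary: C D) (auto simp: bond_mono)

text \<open>Each step is \<open>bond_nearest_chain\<close> at stage \<open>m\<close>, pushed down to
  stage \<open>n\<close> by the monotone bonding maps. Hence the union defining
  \<open>star_seq\<close> is increasing.\<close>

lemma bonds_nearest_incseq:
  assumes "compact X" "faso X \<epsilon> A" "x \<in> X" "n \<ge> 1" "n \<le> k" "k \<le> m"
  shows "bonds \<epsilon> A n k (nearest (A k) x) \<subseteq> bonds \<epsilon> A n m (nearest (A m) x)"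
  using \<open>k \<le> m\<close>
proof (induction m rule: dec_induct)
  case (step m)
  have "n \<le> m" "1 \<le> m" using step assms by auto
  then show ?case
    using step.IH bonds_mono[OF bond_nearest_chain[OF assms(1-3) \<open>1 \<le> m\<close>]] by fastforce
qed simp

lemma star_seq_subset:
  assumes "compact X" "faso X \<epsilon> A" "x \<in> X" "n \<ge> 1" "a \<in> star_seq \<epsilon> A x n"
  shows "a \<in> A n" "dist x a < 2 * \<epsilon> n"
proof -
  obtain m where "n < m" "a \<in> bonds \<epsilon> A n m (nearest (A m) x)"
    using assms(5) unfolding star_seq_def by blast
  then show "a \<in> A n" "dist x a < 2 * \<epsilon> n"
    using bonds_nearest_close[OF assms(1-3) less_imp_le assms(4)] by blast+
qed

lemma star_seq_in_small_subsets:
  assumes "compact X" "faso X \<epsilon> A" "x \<in> X" "n \<ge> 1"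
  shows "star_seq \<epsilon> A x n \<in> small_subsets (4 * \<epsilon> n) (A n)"
proof -
  have "phi \<epsilon> A x n \<in> small_subsets (4 * \<epsilon> n) (A n)"
    using phi_in_inverse_limit[OF assms(1-3)] assms(4)
    unfolding inverse_limit_def by (auto simp: topspace_subtopology)
  then show ?thesis using assms(4) by (simp add: phi_def)
qed

text \<open>A finite union of an increasing chain is already one of its terms. This trades the
  infinite union for a single stage, from which a radius of continuity can be read off.\<close>

lemma star_seq_attained:
  assumes "compact X" "faso X \<epsilon> A" "x \<in> X" "n \<ge> 1"
  obtains m where "n < m" "star_seq \<epsilon> A x n = bonds \<epsilon> A n m (nearest (A m) x)"
proof -
  let ?F = "\<lambda>m. bonds \<epsilon> A n m (nearest (A m) x)"
  have "finite (A n)"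
    using assms unfolding faso_def eps_approximation_def by auto
  then have "finite (star_seq \<epsilon> A x n)"
    using star_seq_subset[OF assms] by (meson finite_subset subsetI)
  moreover have "\<forall>a\<in>star_seq \<epsilon> A x n. \<exists>m>n. a \<in> ?F m"
    unfolding star_seq_def by blast
  then obtain k where k: "\<And>a. a \<in> star_seq \<epsilon> A x n \<Longrightarrow> n < k a \<and> a \<in> ?F (k a)"
    by metis
  ultimately have fin: "finite (insert (Suc n) (k ` star_seq \<epsilon> A x n))" by simp
  \<comment> \<open>Inserting \<open>Suc n\<close> forces \<open>n < m\<close>.\<close>
  define m where "m = Max (insert (Suc n) (k ` star_seq \<epsilon> A x n))"
  have "n < m"
    using Max_ge[OF fin, of "Suc n"] unfolding m_def by simp
  have "a \<in> ?F m" if "a \<in> star_seq \<epsilon> A x n" for a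
  proof -
    have "k a \<le> m" using that fin unfolding m_def by (intro Max_ge) auto
    then show ?thesis
      using bonds_nearest_incseq[OF assms, of "k a" m] k[OF that] by auto
  qed
  moreover have "?F m \<subseteq> star_seq \<epsilon> A x n"
    using \<open>n < m\<close> unfolding star_seq_def by blast
  ultimately show thesis using that \<open>n < m\<close> by blast
qed

text \<open>This extends \<open>bond_nearest_chain\<close>, the case \<open>y = x\<close>. The
  factor 2 in the bound on the radii leaves room for two errors below
  \<open>\<epsilon> (Suc m)\<close>: one from \<open>y\<close> to its nearest point
  \<open>b\<close>, one from \<open>x\<close> to \<open>y\<close>.\<close>

lemma nearest_subset_bond_nearby:
  assumes "compact X" "faso X \<epsilon> A" "x \<in> X" "y \<in> X" "m \<ge> 1" "dist x y < \<epsilon> (Suc m)"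
  shows "nearest (A m) x \<subseteq> bond \<epsilon> A m (nearest (A (Suc m)) y)"
proof
  fix a assume a: "a \<in> nearest (A m) x"
  have e: "eps_approximation X (\<epsilon> (Suc m)) (A (Suc m))"
      "\<epsilon> (Suc m) < (\<epsilon> m - gap X (A m)) / 2"
    using assms unfolding faso_def by auto
  obtain b where b: "b \<in> nearest (A (Suc m)) y"
    using nearest_nonempty[of "A (Suc m)" y] e(1) assms(4)
    unfolding eps_approximation_def by blast
  have "dist y b < \<epsilon> (Suc m)" "dist x a \<le> gap X (A m)"
    using a b infdist_less_eps[OF e(1) assms(4)] infdist_le_gap[OF assms(1,3)]
    unfolding nearest_def by auto
  moreover have "dist b a \<le> dist y b + dist x y + dist x a"
    by metric
  ultimately have "dist b a < \<epsilon> m"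
    using e(2) assms(6) by (auto simp: field_simps)
  then show "a \<in> bond \<epsilon> A m (nearest (A (Suc m)) y)"
    using a b unfolding bond_def nearest_def by auto
qed

lemma star_seq_locally_increasing:
  assumes "compact X" "faso X \<epsilon> A" "x \<in> X" "n \<ge> 1"
  obtains d where "d > 0"
    "\<And>y. y \<in> X \<Longrightarrow> dist x y < d \<Longrightarrow> star_seq \<epsilon> A x n \<subseteq> star_seq \<epsilon> A y n"
proof -
  obtain m where m: "n < m" "star_seq \<epsilon> A x n = bonds \<epsilon> A n m (nearest (A m) x)"
    using star_seq_attained[OF assms] .
  \<comment> \<open>Stage \<open>m\<close> computes the whole coordinate of \<open>x\<close>; one
    stage further, the points nearest to \<open>y\<close> already cover it.\<close>
  have "star_seq \<epsilon> A x n \<subseteq> star_seq \<epsilon> A y n" if y: "y \<in> X" "dist x y < \<epsilon> (Suc m)" for y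
  proof -
    have "nearest (A m) x \<subseteq> bond \<epsilon> A m (nearest (A (Suc m)) y)"
      using nearest_subset_bond_nearby[OF assms(1-3)] y m(1) by simp
    then have "star_seq \<epsilon> A x n \<subseteq> bonds \<epsilon> A n (Suc m) (nearest (A (Suc m)) y)"
      unfolding m(2) using bonds_mono[of "nearest (A m) x" _ \<epsilon> A n m] m(1) by simp
    also have "\<dots> \<subseteq> star_seq \<epsilon> A y n"
      unfolding star_seq_def using m(1) by (intro UN_upper) simp
    finally show ?thesis .
  qed
  moreover have "0 < \<epsilon> (Suc m)"
    using assms(2) m(1) unfolding faso_def by auto
  ultimately show thesis using that by blast
qed

lemma continuous_map_star_seq:
  assumes "compact X" "faso X \<epsilon> A" "n \<ge> 1"
  shows "continuous_map (top_of_set X) (small_subsets_topology (4 * \<epsilon> n) (A n))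
    (\<lambda>x. star_seq \<epsilon> A x n)"
  unfolding continuous_map_def
proof (intro conjI allI impI)
  show "(\<lambda>x. star_seq \<epsilon> A x n) \<in> topspace (top_of_set X)
      \<rightarrow> topspace (small_subsets_topology (4 * \<epsilon> n) (A n))"
    using star_seq_in_small_subsets[OF assms(1,2) _ assms(3)] by auto
next
  fix U assume U: "openin (small_subsets_topology (4 * \<epsilon> n) (A n)) U"
  have "\<exists>d>0. \<forall>y\<in>X. dist y x < d \<longrightarrow> star_seq \<epsilon> A y n \<in> U"
    if x: "x \<in> X" "star_seq \<epsilon> A x n \<in> U" for x
  proof -
    obtain d where d: "d > 0"
      "\<And>y. y \<in> X \<Longrightarrow> dist x y < d \<Longrightarrow> star_seq \<epsilon> A x n \<subseteq> star_seq \<epsilon> A y n"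
      using star_seq_locally_increasing[OF assms(1,2) x(1) assms(3)] by blast
    \<comment> \<open>The order is reverse inclusion, so \<open>U\<close>, a lower set, contains
      every admissible superset of its members.\<close>
    have "star_seq \<epsilon> A y n \<in> U" if "y \<in> X" "dist y x < d" for y
      using U x d(2)[of y] that star_seq_in_small_subsets[OF assms(1,2) that(1) assms(3)]
      unfolding openin_small_subsets_topology opp_le_def by (auto simp: dist_commute)
    with d(1) show ?thesis by blast
  qed
  then show "openin (top_of_set X) {x \<in> topspace (top_of_set X). star_seq \<epsilon> A x n \<in> U}"
    unfolding openin_euclidean_subtopology_iff by fastforce
qed

lemma continuous_map_phi:
  assumes "compact X" "faso X \<epsilon> A"
  shows "continuous_map (top_of_set X) (star_space X \<epsilon> A) (phi \<epsilon> A)"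
proof -
  have "continuous_map (top_of_set X)
      (product_topology (\<lambda>n. small_subsets_topology (4 * \<epsilon> n) (A n)) {1..}) (phi \<epsilon> A)"
    using continuous_map_star_seq[OF assms]
    unfolding continuous_map_componentwise phi_def by auto
  moreover have "phi \<epsilon> A x \<in> {C. \<forall>n\<ge>1. bond \<epsilon> A n (C (Suc n)) = C n}" if "x \<in> X" for x
    using phi_in_inverse_limit[OF assms that]
    unfolding inverse_limit_def topspace_subtopology by blast
  ultimately show ?thesis
    unfolding star_space_def inverse_limit_def continuous_map_in_subtopology by auto
qed

lemma openin_star_space_coordinate:
  assumes "n \<ge> 1" "openin (small_subsets_topology (4 * \<epsilon> n) (A n)) U"
  shows "openin (star_space X \<epsilon> A) {C \<in> topspace (star_space X \<epsilon> A). C n \<in> U}"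
proof -
  have "continuous_map (star_space X \<epsilon> A) (small_subsets_topology (4 * \<epsilon> n) (A n)) (\<lambda>C. C n)"
    unfolding star_space_def inverse_limit_def using assms(1)
    by (intro continuous_map_from_subtopology continuous_map_product_projection) simp
  then show ?thesis using assms(2) by (rule openin_continuous_map_preimage)
qed

text \<open>Yields both injectivity of \<open>phi\<close> and the Hausdorff property of its
  image.\<close>

lemma phi_separated:
  assumes "compact X" "faso X \<epsilon> A" "x \<in> X" "y \<in> X" "x \<noteq> y"
  obtains U V where "openin (star_space X \<epsilon> A) U" "openin (star_space X \<epsilon> A) V"
    "phi \<epsilon> A x \<in> U" "phi \<epsilon> A y \<in> V" "disjnt U V"
proof -
  \<comment> \<open>The 8 anticipates a path from \<open>x\<close> to \<open>y\<close> in four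
    steps, each shorter than \<open>2 * \<epsilon> n\<close>.\<close>
  have "X \<noteq> {}" "0 < dist x y / 8" using assms by auto
  from faso_eps_small[OF assms(1) this(1) assms(2) this(2)]
  obtain n where n: "n \<ge> 1" "\<epsilon> n < dist x y / 8" .
  \<comment> \<open>\<open>M w\<close> is the minimal open neighbourhood of the coordinate, and
    \<open>N w\<close> its preimage in the image of \<open>phi\<close>.\<close>
  define M where "M w = {D \<in> small_subsets (4 * \<epsilon> n) (A n). star_seq \<epsilon> A w n \<subseteq> D}" for w
  define N where "N w = {C \<in> topspace (star_space X \<epsilon> A). C n \<in> M w}" for w
  have "openin (small_subsets_topology (4 * \<epsilon> n) (A n)) (M w)" for w
    unfolding openin_small_subsets_topology opp_le_def M_def by blast
  then have op: "openin (star_space X \<epsilon> A) (N w)" for w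
    unfolding N_def by (intro openin_star_space_coordinate n(1))
  have mem: "phi \<epsilon> A w \<in> N w" if "w \<in> X" for w
    using that n(1) star_seq_in_small_subsets[OF assms(1,2) that n(1)]
    unfolding N_def M_def topspace_star_space[OF assms(1,2)] by (simp add: phi_def)
  have disj: "disjnt (N x) (N y)"
    unfolding disjnt_iff
  proof (intro allI notI, elim conjE)
    fix C assume C: "C \<in> N x" "C \<in> N y"
    \<comment> \<open>Working inside the image matters here: a common point comes from some
      \<open>z\<close>, and its coordinate, close to \<open>z\<close>, contains points close to
      \<open>x\<close> and points close to \<open>y\<close>.\<close>
    then obtain z where z: "z \<in> X" "C = phi \<epsilon> A z"
      unfolding N_def topspace_star_space[OF assms(1,2)] by blast
    have sub: "star_seq \<epsilon> A x n \<subseteq> star_seq \<epsilon> A z n" "star_seq \<epsilon> A y n \<subseteq> star_seq \<epsilon> A z n"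
      using C z n(1) unfolding N_def M_def by (auto simp: phi_def)
    obtain a b where ab: "a \<in> star_seq \<epsilon> A x n" "b \<in> star_seq \<epsilon> A y n"
      using star_seq_in_small_subsets[OF assms(1,2) _ n(1)] assms(3,4)
      unfolding small_subsets_def by blast
    note close = star_seq_subset(2)[OF assms(1,2) _ n(1)]
    have "dist x a < 2 * \<epsilon> n" "dist y b < 2 * \<epsilon> n" "dist z a < 2 * \<epsilon> n" "dist z b < 2 * \<epsilon> n"
      using close assms(3,4) z(1) ab sub by blast+
    moreover have "dist x y \<le> dist x a + dist z a + dist z b + dist y b" by metric
    ultimately show False using n(2) by linarith
  qed
  show thesis using that op mem assms(3,4) disj by blast
qed

lemma inj_on_phi:
  assumes "compact X" "faso X \<epsilon> A"
  shows "inj_on (phi \<epsilon> A) X"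
  by (rule inj_onI) (metis phi_separated[OF assms] disjnt_iff)

lemma Hausdorff_space_star_space:
  assumes "compact X" "faso X \<epsilon> A"
  shows "Hausdorff_space (star_space X \<epsilon> A)"
  unfolding Hausdorff_space_def topspace_star_space[OF assms]
  using phi_separated[OF assms] by (smt (verit) imageE)

theorem theorem3p13:
  fixes X :: "'a::metric_space set" and \<epsilon> :: "nat \<Rightarrow> real" and A :: "nat \<Rightarrow> 'a set"
  assumes "compact X" and "X \<noteq> {}"
    and "faso X \<epsilon> A"
  shows "top_of_set X homeomorphic_space star_space X \<epsilon> A"
proof -
  have "homeomorphic_map (top_of_set X) (star_space X \<epsilon> A) (phi \<epsilon> A)"
  proof (rule continuous_imp_homeomorphic_map)
    show "compact_space (top_of_set X)"
      using assms(1) by (simp add: compact_space_subtopology)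
  \<comment> \<open>Surjectivity is \<open>topspace_star_space\<close>.\<close>
  qed (simp_all add: continuous_map_phi Hausdorff_space_star_space inj_on_phi
        topspace_star_space assms)
  then show ?thesis by (rule homeomorphic_map_imp_homeomorphic_space)
qed

end
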